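(* Let $(\Omega,\mathcal{F},\mu)$ be a measure space, $p\in[1,+\infty)$, $k\geq 1$ an integer, and let $X$ be a dual Banach space with $w^*$-sequentially compact unit ball. Then $\mathscr{G}_{p,k}(X)$ is proximinal in $L^p(\Omega,\mathcal{F},\mu,X)$; that is, for every $f\in L^p(\Omega,\mathcal{F},\mu,X)$ there exists $g\in\mathscr{G}_{p,k}(X)$ such that $\|f-g\|_p=\inf_{h\in\mathscr{G}_{p,k}(X)}\|f-h\|_p$.
   Context: A simple function is a function $\sum_{i=1}^n x_i\mathbf{1}_{A_i}$ with $n\ge 1$, $x_i\in X$, $A_i\in\mathcal{F}$. A function $f:\Omega\to X$ is strongly measurable if it is a pointwise limit of a sequence of simple functions. For $1\le p<\infty$, $L^p(X)=L^p(\Omega,\mathcal{F},\mu,X)$ is the Bochner space of strongly measurable $f:\Omega\to X$ with $\int_\Omega\|f\|^p\,d\mu<\infty$ (functions equal a.e. are identified), with norm $\|f\|_p=\left(\int_\Omega\|f\|^p\,d\mu\right)^{1/p}$. $\mathscr{G}_{p,k}(X)$ is the set of all functions $\sum_{i=1}^{l}x_i\mathbf{1}_{A_i}\in L^p(X)$ with $l\le k$, $\{A_i\}_{1\le i\le l}\subset\mathcal{F}$ a partition of $\Omega$, and $x_1,\dots,x_l\in X$. "$X$ is a dual Banach space" means $X=Y^*$ for some Banach space $Y$, and the $w^*$-topology is that of $Y^*$ with respect to $Y$. *)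

theory Defs
  imports "HOL-Analysis.Analysis"
begin

definition strongly_measurable :: "'a measure \<Rightarrow> ('a \<Rightarrow> 'b::real_normed_vector) \<Rightarrow> bool" where
  "strongly_measurable M f \<longleftrightarrow>
    (\<exists>s. (\<forall>n. simple_function M (s n)) \<and> (\<forall>\<omega>\<in>space M. (\<lambda>n. s n \<omega>) \<longlonglongrightarrow> f \<omega>))"

lemma simple_function_iff_sum_indicator:
  fixes f :: "'a \<Rightarrow> 'b::real_normed_vector"
  shows "simple_function M f \<longleftrightarrow>
    (\<exists>n::nat. n \<ge> 1 \<and> (\<exists>x A. A ` {1..n} \<subseteq> sets M \<and>
      (\<forall>\<omega>\<in>space M. f \<omega> = (\<Sum>i=1..n. indicator (A i) \<omega> *\<^sub>R x i))))"
    (is "_ \<longleftrightarrow> ?R")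
proof
  assume f: "simple_function M f"
  let ?V = "insert 0 (f ` space M)"
  have fin: "finite ?V"
    using simple_functionD(1)[OF f] by simp
  obtain x where x: "bij_betw x {1..card ?V} ?V"
    using ex_bij_betw_nat_finite_1[OF fin] by blast
  define A where "A i = f -` {x i} \<inter> space M" for i
  have "f \<omega> = (\<Sum>i=1..card ?V. indicator (A i) \<omega> *\<^sub>R x i)" if w: "\<omega> \<in> space M" for \<omega>
  proof -
    have "(\<Sum>i=1..card ?V. indicator (A i) \<omega> *\<^sub>R x i)
        = (\<Sum>i=1..card ?V. (if x i = f \<omega> then x i else 0))"
      using w by (intro sum.cong) (auto simp: A_def)
    also have "\<dots> = (\<Sum>v\<in>?V. if v = f \<omega> then v else 0)"
      by (rule sum.reindex_bij_betw[OF x])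
    also have "\<dots> = f \<omega>"
      using fin w by (subst sum.delta) auto
    finally show ?thesis by simp
  qed
  moreover have "A ` {1..card ?V} \<subseteq> sets M"
    using simple_functionD(2)[OF f] by (auto simp: A_def)
  moreover have "card ?V \<ge> 1"
    using fin by (simp add: card_gt_0_iff Suc_le_eq)
  ultimately show ?R
    by (intro exI[of _ "card ?V"] exI[of _ x] exI[of _ A] conjI ballI) (assumption | simp only:)+
next
  assume ?R
  then obtain n x A where A: "A ` {1..n::nat} \<subseteq> sets M"
    and f: "\<And>\<omega>. \<omega> \<in> space M \<Longrightarrow> f \<omega> = (\<Sum>i=1..n. indicator (A i) \<omega> *\<^sub>R x i)"
    by metis
  have "simple_function M (\<lambda>\<omega>. indicator (A i) \<omega> *\<^sub>R x i)" if "i \<in> {1..n}" for i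
  proof -
    have "simple_function M (indicator (A i) :: 'a \<Rightarrow> real)"
      using A that by (intro simple_function_indicator) auto
    from simple_function_compose1[OF this, of "\<lambda>r. r *\<^sub>R x i"] show ?thesis by simp
  qed
  then have "simple_function M (\<lambda>\<omega>. \<Sum>i=1..n. indicator (A i) \<omega> *\<^sub>R x i)"
    by (rule simple_function_sum)
  then show "simple_function M f"
    by (subst simple_function_cong[OF f])
qed

text \<open>Elements of \<open>L\<^sup>p\<close> are represented by functions, without passing to classes
  modulo equality almost everywhere.\<close>

definition bochner_Lp :: "'a measure \<Rightarrow> real \<Rightarrow> ('a \<Rightarrow> 'b::real_normed_vector) set" where
  "bochner_Lp M p = {f. strongly_measurable M f \<and> (\<integral>\<^sup>+\<omega>. ennreal (norm (f \<omega>) powr p) \<partial>M) < \<infinity>}"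

definition Lp_norm :: "'a measure \<Rightarrow> real \<Rightarrow> ('a \<Rightarrow> 'b::real_normed_vector) \<Rightarrow> real" where
  "Lp_norm M p f = (\<integral>\<omega>. norm (f \<omega>) powr p \<partial>M) powr (1 / p)"

text \<open>Parts of the partition may be empty; as at most \<open>k\<close> parts are allowed, this
  gives the same functions as partitions into nonempty parts.\<close>

definition G_set :: "'a measure \<Rightarrow> real \<Rightarrow> nat \<Rightarrow> ('a \<Rightarrow> 'b::real_normed_vector) set" where
  "G_set M p k = bochner_Lp M p \<inter>
    {(\<lambda>\<omega>. \<Sum>i=1..l. indicator (A i) \<omega> *\<^sub>R x i) | (l::nat) A x.
      l \<le> k \<and> A ` {1..l} \<subseteq> sets M \<and> disjoint_family_on A {1..l} \<and> (\<Union>i\<in>{1..l}. A i) = space M}"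

definition seq_compactin :: "'a topology \<Rightarrow> 'a set \<Rightarrow> bool" where
  "seq_compactin T S \<longleftrightarrow> S \<subseteq> topspace T \<and>
    (\<forall>\<sigma>::nat \<Rightarrow> 'a. range \<sigma> \<subseteq> S \<longrightarrow>
      (\<exists>l\<in>S. \<exists>r::nat \<Rightarrow> nat. strict_mono r \<and> limitin T (\<sigma> \<circ> r) l sequentially))"

text \<open>For functionals the strong operator topology is the topology of pointwise convergence on
  \<open>Y\<close>, i.e. the weak-* topology of the dual \<open>Y \<Rightarrow>\<^sub>L real\<close>.\<close>

abbreviation weak_star_topology :: "('y::real_normed_vector \<Rightarrow>\<^sub>L real) topology" where
  "weak_star_topology \<equiv> strong_operator_topology"

lemma limitin_weak_star_iff:
  fixes \<phi> :: "nat \<Rightarrow> 'y::real_normed_vector \<Rightarrow>\<^sub>L real"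
  shows "limitin weak_star_topology \<phi> l sequentially \<longleftrightarrow>
    (\<forall>y. (\<lambda>n. blinfun_apply (\<phi> n) y) \<longlonglongrightarrow> blinfun_apply l y)"
proof
  assume L: "limitin weak_star_topology \<phi> l sequentially"
  show "\<forall>y. (\<lambda>n. blinfun_apply (\<phi> n) y) \<longlonglongrightarrow> blinfun_apply l y"
    using continuous_map_limit[OF strong_operator_topology_continuous_evaluation L]
    by (simp add: o_def)
next
  assume R: "\<forall>y. (\<lambda>n. blinfun_apply (\<phi> n) y) \<longlonglongrightarrow> blinfun_apply l y"
  show "limitin weak_star_topology \<phi> l sequentially"
    unfolding limitin_def
  proof (intro conjI allI impI)
    show "l \<in> topspace weak_star_topology"
      by (simp add: strong_operator_topology_topspace)
  next
    fix U :: "('y \<Rightarrow>\<^sub>L real) set"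
    assume "openin weak_star_topology U \<and> l \<in> U"
    then obtain V where V: "open V" "U = blinfun_apply -` V" "l \<in> U"
      unfolding strong_operator_topology_def by (auto simp: openin_pullback_topology)
    have "limitin euclidean (\<lambda>n. blinfun_apply (\<phi> n)) (blinfun_apply l) sequentially"
      using R by (simp add: limitin_componentwise flip: euclidean_product_topology)
    then have "(\<lambda>n. blinfun_apply (\<phi> n)) \<longlonglongrightarrow> blinfun_apply l"
      by simp
    then show "\<forall>\<^sub>F n in sequentially. \<phi> n \<in> U"
      using V by (auto dest: topological_tendstoD)
  qed
qed

end

theory Submission
  imports Defs
begin

text \<open>
  A function of \<open>G_set M p k\<close> is given by at most \<open>k\<close> values and a rule that assigns one of them to
  each point. For fixed values \<open>x 1, \<dots>, x k\<close> the best rule chooses a value nearest to \<open>f \<omega>\<close>, so the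
  task is to minimise \<open>\<integral> min\<^sub>i \<parallel>f - x i\<parallel> powr p\<close> over all \<open>k\<close>-tuples \<open>x\<close>. This is the direct method
  of the calculus of variations, with one obstacle: the tuples of a minimising sequence may
  contain components that are not bounded.

  The obstacle disappears if compactness is weakened to exactly what the minimisation consumes.
  Say that \<open>l\<close> is a norm-lower limit of \<open>\<sigma>\<close> if \<open>\<parallel>v - l\<parallel> \<le> liminf \<parallel>v - \<sigma> n\<parallel>\<close> for every \<open>v\<close>. A weak-*
  limit is a norm-lower limit since the dual norm is weak-* lower semicontinuous, and if
  \<open>\<parallel>\<sigma> n\<parallel> \<rightarrow> \<infinity>\<close>, then every \<open>l\<close> is one, because the right-hand side is infinite. Hence, when the dual
  unit ball is weak-* sequentially compact, every sequence, bounded or not, has a subsequence with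
  a norm-lower limit (\<open>weak_star_norm_lower_limit_subseq\<close>), and so do the components of a
  sequence of \<open>k\<close>-tuples simultaneously (\<open>norm_lower_limit_subseq_finite\<close>).

  Let \<open>g\<close> select from the limit tuple a value nearest to \<open>f\<close>. Since only finitely many values
  compete, \<open>\<parallel>f - g\<parallel>\<close> is pointwise at most the lower limit of \<open>\<parallel>f - h n\<parallel>\<close> along the subsequence of the
  minimising sequence \<open>h\<close>, and Fatou's lemma shows that \<open>g\<close> attains the infimum. That \<open>g\<close> belongs
  to \<open>L\<^sup>p\<close>, also on a space of infinite measure, follows from \<open>f\<close> and \<open>f - g\<close> being \<open>p\<close>-integrable.
\<close>

section \<open>Strongly measurable functions\<close>

lemma strongly_measurable_simple:
  "simple_function M f \<Longrightarrow> strongly_measurable M f"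
  unfolding strongly_measurable_def by (intro exI[of _ "\<lambda>_. f"]) auto

text \<open>The approximating simple functions are subtracted, because the difference of two Borel
  functions need not be Borel when the space is not second countable.\<close>

lemma strongly_measurable_diff:
  assumes "strongly_measurable M f" "strongly_measurable M g"
  shows "strongly_measurable M (\<lambda>\<omega>. f \<omega> - g \<omega>)"
proof -
  obtain s t where "\<And>n. simple_function M (s n)" "\<And>\<omega>. \<omega> \<in> space M \<Longrightarrow> (\<lambda>n. s n \<omega>) \<longlonglongrightarrow> f \<omega>"
    "\<And>n. simple_function M (t n)" "\<And>\<omega>. \<omega> \<in> space M \<Longrightarrow> (\<lambda>n. t n \<omega>) \<longlonglongrightarrow> g \<omega>"
    using assms unfolding strongly_measurable_def by metis
  then show ?thesis
    unfolding strongly_measurable_def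
    by (intro exI[of _ "\<lambda>n \<omega>. s n \<omega> - t n \<omega>"])
       (auto intro!: simple_function_diff tendsto_diff)
qed

lemma borel_measurable_norm_strongly_measurable:
  assumes "strongly_measurable M f"
  shows "(\<lambda>\<omega>. norm (f \<omega>)) \<in> borel_measurable M"
proof -
  obtain s where s: "\<And>n. simple_function M (s n)" "\<And>\<omega>. \<omega> \<in> space M \<Longrightarrow> (\<lambda>n. s n \<omega>) \<longlonglongrightarrow> f \<omega>"
    using assms unfolding strongly_measurable_def by metis
  show ?thesis
  proof (rule borel_measurable_LIMSEQ_metric)
    show "(\<lambda>\<omega>. norm (s n \<omega>)) \<in> borel_measurable M" for n
      using simple_function_compose1[OF s(1)] by (rule borel_measurable_simple_function)
    show "(\<lambda>n. norm (s n \<omega>)) \<longlonglongrightarrow> norm (f \<omega>)" if "\<omega> \<in> space M" for \<omega>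
      using s(2)[OF that] by (rule tendsto_norm)
  qed
qed

lemma powr_add_le:
  fixes a b p :: real
  assumes "0 \<le> a" "0 \<le> b" "0 \<le> p"
  shows "(a + b) powr p \<le> 2 powr p * (a powr p + b powr p)"
proof -
  have "(a + b) powr p \<le> (2 * max a b) powr p"
    using assms by (intro powr_mono2) auto
  also have "\<dots> = 2 powr p * max a b powr p"
    using assms by (simp add: powr_mult)
  also have "max a b powr p \<le> a powr p + b powr p"
    by (simp add: max_def)
  finally show ?thesis by simp
qed

lemma bochner_Lp_diff:
  assumes "0 \<le> p" "f \<in> bochner_Lp M p" "g \<in> bochner_Lp M p"
  shows "(\<lambda>\<omega>. f \<omega> - g \<omega>) \<in> bochner_Lp M p"
proof -
  have f: "strongly_measurable M f" "(\<integral>\<^sup>+\<omega>. ennreal (norm (f \<omega>) powr p) \<partial>M) < \<infinity>"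
    and g: "strongly_measurable M g" "(\<integral>\<^sup>+\<omega>. ennreal (norm (g \<omega>) powr p) \<partial>M) < \<infinity>"
    using assms by (auto simp: bochner_Lp_def)
  note [measurable] = borel_measurable_norm_strongly_measurable[OF f(1)]
    borel_measurable_norm_strongly_measurable[OF g(1)]
  have "norm (f \<omega> - g \<omega>) powr p \<le> 2 powr p * (norm (f \<omega>) powr p + norm (g \<omega>) powr p)" for \<omega>
  proof -
    have "norm (f \<omega> - g \<omega>) powr p \<le> (norm (f \<omega>) + norm (g \<omega>)) powr p"
      using assms(1) by (intro powr_mono2 norm_triangle_ineq4) auto
    also have "\<dots> \<le> 2 powr p * (norm (f \<omega>) powr p + norm (g \<omega>) powr p)"
      using assms(1) by (intro powr_add_le) auto
    finally show ?thesis .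
  qed
  then have "(\<integral>\<^sup>+\<omega>. ennreal (norm (f \<omega> - g \<omega>) powr p) \<partial>M)
      \<le> (\<integral>\<^sup>+\<omega>. ennreal (2 powr p) * (ennreal (norm (f \<omega>) powr p) + ennreal (norm (g \<omega>) powr p)) \<partial>M)"
    by (intro nn_integral_mono) (simp flip: ennreal_plus ennreal_mult)
  also have "\<dots> = ennreal (2 powr p) * ((\<integral>\<^sup>+\<omega>. ennreal (norm (f \<omega>) powr p) \<partial>M)
      + (\<integral>\<^sup>+\<omega>. ennreal (norm (g \<omega>) powr p) \<partial>M))"
    by (simp add: nn_integral_cmult nn_integral_add)
  also have "\<dots> < \<infinity>"
    using f(2) g(2) by (simp add: ennreal_mult_less_top)
  finally show ?thesis
    using strongly_measurable_diff[OF f(1) g(1)] by (simp add: bochner_Lp_def)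
qed

lemma Lp_norm_mono:
  assumes "0 \<le> p" "u \<in> bochner_Lp M p" "w \<in> bochner_Lp M p"
    and "(\<integral>\<^sup>+\<omega>. ennreal (norm (u \<omega>) powr p) \<partial>M) \<le> (\<integral>\<^sup>+\<omega>. ennreal (norm (w \<omega>) powr p) \<partial>M)"
  shows "Lp_norm M p u \<le> Lp_norm M p w"
proof -
  have [measurable]: "(\<lambda>\<omega>. norm (u \<omega>)) \<in> borel_measurable M" "(\<lambda>\<omega>. norm (w \<omega>)) \<in> borel_measurable M"
    using assms by (auto simp: bochner_Lp_def intro: borel_measurable_norm_strongly_measurable)
  have "(\<integral>\<omega>. norm (u \<omega>) powr p \<partial>M) \<le> (\<integral>\<omega>. norm (w \<omega>) powr p \<partial>M)"
    using assms(3,4) by (simp add: integral_eq_nn_integral enn2real_mono bochner_Lp_def)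
  then show ?thesis
    unfolding Lp_norm_def using assms(1) by (intro powr_mono2) auto
qed

section \<open>Functions with at most \<open>k\<close> values\<close>

lemma sum_indicator_disjoint_family:
  fixes x :: "'i \<Rightarrow> 'b::real_normed_vector"
  assumes "finite I" "disjoint_family_on A I" "i \<in> I" "\<omega> \<in> A i"
  shows "(\<Sum>j\<in>I. indicator (A j) \<omega> *\<^sub>R x j) = x i"
proof -
  have "(\<Sum>j\<in>I. indicator (A j) \<omega> *\<^sub>R x j) = (\<Sum>j\<in>I. if j = i then x j else 0)"
    using assms by (intro sum.cong) (auto simp: indicator_def disjoint_family_on_def)
  then show ?thesis
    using assms by simp
qed

lemma G_set_values:
  assumes "h \<in> G_set M p k"
  obtains x where "\<And>\<omega>. \<omega> \<in> space M \<Longrightarrow> \<exists>i\<in>{1..k}. h \<omega> = x i"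
proof -
  obtain l A x where h: "h = (\<lambda>\<omega>. \<Sum>i=1..l. indicator (A i) \<omega> *\<^sub>R x i)" and "l \<le> k"
    and A: "disjoint_family_on A {1..l}" "(\<Union>i\<in>{1..l}. A i) = space M"
    using assms by (auto simp: G_set_def)
  have "\<exists>i\<in>{1..k}. h \<omega> = x i" if w: "\<omega> \<in> space M" for \<omega>
  proof -
    obtain i where i: "i \<in> {1..l}" "\<omega> \<in> A i"
      using A(2) w by blast
    then have "h \<omega> = x i"
      unfolding h by (intro sum_indicator_disjoint_family A) auto
    then show ?thesis
      using i \<open>l \<le> k\<close> by force
  qed
  then show ?thesis by (rule that)
qed

lemma zero_in_G_set:
  assumes "1 \<le> k" "p \<noteq> 0"
  shows "(\<lambda>_. 0) \<in> G_set M p k"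
proof -
  have "(\<lambda>_. 0) \<in> bochner_Lp M p"
    using assms(2) by (simp add: bochner_Lp_def strongly_measurable_simple)
  moreover have "\<exists>l A x. (\<lambda>_. 0) = (\<lambda>\<omega>. \<Sum>i=1..l. indicator (A i) \<omega> *\<^sub>R (x i :: 'b)) \<and> l \<le> k \<and>
      A ` {1..l} \<subseteq> sets M \<and> disjoint_family_on A {1..l} \<and> (\<Union>i\<in>{1..l}. A i) = space M"
    using assms(1)
    by (intro exI[of _ "1::nat"] exI[of _ "\<lambda>_. space M"] exI[of _ "\<lambda>_. 0"])
       (auto simp: disjoint_family_on_def)
  ultimately show ?thesis by (auto simp: G_set_def)
qed

text \<open>Ties between nearest values are broken by the least index, which keeps the parts disjoint
  and measurable.\<close>

lemma nearest_value_selection: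
  fixes f :: "'a \<Rightarrow> 'b::real_normed_vector" and k :: nat
  assumes k: "1 \<le> k" and f: "strongly_measurable M f"
  obtains A where "A ` {1..k} \<subseteq> sets M" "disjoint_family_on A {1..k}"
    "(\<Union>i\<in>{1..k}. A i) = space M"
    "\<And>i j \<omega>. i \<in> {1..k} \<Longrightarrow> \<omega> \<in> A i \<Longrightarrow> j \<in> {1..k} \<Longrightarrow> norm (f \<omega> - x i) \<le> norm (f \<omega> - x j)"
proof -
  define D where "D i \<omega> = norm (f \<omega> - x i)" for i \<omega>
  define P where "P i \<omega> \<longleftrightarrow> i \<in> {1..k} \<and> (\<forall>j\<in>{1..k}. D i \<omega> \<le> D j \<omega>)" for i \<omega>
  define N where "N \<omega> = (LEAST i. P i \<omega>)" for \<omega>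
  have [measurable]: "D i \<in> borel_measurable M" for i
    unfolding D_def
    by (intro borel_measurable_norm_strongly_measurable strongly_measurable_diff f
        strongly_measurable_simple) simp
  have [measurable]: "Measurable.pred M (P i)" for i
    unfolding P_def by measurable
  have N_meas: "N \<in> measurable M (count_space UNIV)"
    unfolding N_def by measurable
  have P: "P (N \<omega>) \<omega>" for \<omega>
  proof -
    have "\<exists>i. is_arg_min (\<lambda>i. D i \<omega>) (\<lambda>i. i \<in> {1..k}) i"
      using k by (intro ex_is_arg_min_if_finite) auto
    then have "\<exists>i. P i \<omega>"
      unfolding is_arg_min_linorder P_def by blast
    then show ?thesis
      unfolding N_def by (rule LeastI_ex)
  qed
  define A where "A i = N -` {i} \<inter> space M" for i
  show ?thesis
  proof
    show "A ` {1..k} \<subseteq> sets M"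
      using N_meas by (auto simp: A_def)
    show "disjoint_family_on A {1..k}"
      by (auto simp: disjoint_family_on_def A_def)
    show "(\<Union>i\<in>{1..k}. A i) = space M"
      using P by (auto simp: A_def P_def)
    show "norm (f \<omega> - x i) \<le> norm (f \<omega> - x j)" if "\<omega> \<in> A i" "j \<in> {1..k}" for i j \<omega>
      using P[of \<omega>] that by (auto simp: A_def P_def D_def)
  qed
qed

text \<open>On a space of infinite measure a function with finitely many values need not be
  \<open>p\<close>-integrable. Here \<open>g = f - (f - g)\<close> is, as soon as \<open>f - g\<close> is; in \<open>G_set_minimizer\<close> the latter
  comes from comparison with the zero function.\<close>

lemma nearest_value_function:
  fixes f :: "'a \<Rightarrow> 'b::real_normed_vector" and k :: nat
  assumes k: "1 \<le> k" and p: "0 \<le> p" and f: "f \<in> bochner_Lp M p"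
  obtains g where "\<And>\<omega> j. \<omega> \<in> space M \<Longrightarrow> j \<in> {1..k} \<Longrightarrow> norm (f \<omega> - g \<omega>) \<le> norm (f \<omega> - x j)"
    "(\<integral>\<^sup>+\<omega>. ennreal (norm (f \<omega> - g \<omega>) powr p) \<partial>M) < \<infinity> \<Longrightarrow> g \<in> G_set M p k"
proof -
  have fm: "strongly_measurable M f"
    using f by (simp add: bochner_Lp_def)
  obtain A where A: "A ` {1..k} \<subseteq> sets M" "disjoint_family_on A {1..k}"
    "(\<Union>i\<in>{1..k}. A i) = space M"
    and near: "\<And>i j \<omega>. i \<in> {1..k} \<Longrightarrow> \<omega> \<in> A i \<Longrightarrow> j \<in> {1..k} \<Longrightarrow> norm (f \<omega> - x i) \<le> norm (f \<omega> - x j)"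
    using nearest_value_selection[OF k fm, of x] by blast
  define g where "g = (\<lambda>\<omega>. \<Sum>i=1..k. indicator (A i) \<omega> *\<^sub>R x i)"
  have "simple_function M g"
    unfolding simple_function_iff_sum_indicator using k A(1)
    by (intro exI[of _ k] conjI exI[of _ x] exI[of _ A]) (auto simp: g_def)
  then have gm: "strongly_measurable M g"
    by (rule strongly_measurable_simple)
  show ?thesis
  proof
    show "norm (f \<omega> - g \<omega>) \<le> norm (f \<omega> - x j)" if w: "\<omega> \<in> space M" and j: "j \<in> {1..k}" for \<omega> j
    proof -
      obtain i where i: "i \<in> {1..k}" "\<omega> \<in> A i"
        using A(3) w by blast
      then have "g \<omega> = x i"
        unfolding g_def by (intro sum_indicator_disjoint_family A) auto
      then show ?thesis
        using near[OF i j] by simp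
    qed
    assume "(\<integral>\<^sup>+\<omega>. ennreal (norm (f \<omega> - g \<omega>) powr p) \<partial>M) < \<infinity>"
    then have "(\<lambda>\<omega>. f \<omega> - g \<omega>) \<in> bochner_Lp M p"
      using strongly_measurable_diff[OF fm gm] by (simp add: bochner_Lp_def)
    from bochner_Lp_diff[OF p f this] have "g \<in> bochner_Lp M p"
      by simp
    then show "g \<in> G_set M p k"
      using A unfolding G_set_def g_def by blast
  qed
qed

section \<open>Norm-lower limits\<close>

text \<open>This is \<open>\<parallel>v - l\<parallel> \<le> liminf \<parallel>v - \<sigma> n\<parallel>\<close> for all \<open>v\<close>, where the lower limit may be infinite.
  A norm-lower limit is not unique: a sequence whose norms tend to infinity has all vectors as
  norm-lower limits.\<close>

definition norm_lower_limit :: "(nat \<Rightarrow> 'b::real_normed_vector) \<Rightarrow> 'b \<Rightarrow> bool" where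
  "norm_lower_limit \<sigma> l \<longleftrightarrow>
    (\<forall>v c. c < norm (v - l) \<longrightarrow> (\<forall>\<^sub>F n in sequentially. c < norm (v - \<sigma> n)))"

lemma norm_lower_limit_subseq:
  assumes "norm_lower_limit \<sigma> l" "strict_mono r"
  shows "norm_lower_limit (\<sigma> \<circ> r) l"
  using assms eventually_subseq[OF assms(2)] unfolding norm_lower_limit_def by auto

lemma norm_lower_limit_at_infinity:
  fixes \<sigma> :: "nat \<Rightarrow> 'b::real_normed_vector"
  assumes "filterlim (\<lambda>n. norm (\<sigma> n)) at_top sequentially"
  shows "norm_lower_limit \<sigma> l"
  unfolding norm_lower_limit_def
proof (intro allI impI)
  fix v :: 'b and c
  have "\<forall>\<^sub>F n in sequentially. norm v + c < norm (\<sigma> n)"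
    using assms by (simp add: filterlim_at_top_dense)
  then show "\<forall>\<^sub>F n in sequentially. c < norm (v - \<sigma> n)"
  proof eventually_elim
    case (elim n)
    then show ?case
      using norm_triangle_ineq2[of "\<sigma> n" v] by (simp add: norm_minus_commute)
  qed
qed

text \<open>The dual norm is a supremum of weak-* continuous functions: any \<open>c < \<parallel>v - l\<parallel>\<close> is beaten at
  a single vector \<open>y\<close>, and at \<open>y\<close> the functionals converge.\<close>

lemma norm_lower_limit_weak_star:
  fixes \<sigma> :: "nat \<Rightarrow> 'y::real_normed_vector \<Rightarrow>\<^sub>L real"
  assumes lim: "\<And>y. (\<lambda>n. blinfun_apply (\<sigma> n) y) \<longlonglongrightarrow> blinfun_apply l y"
  shows "norm_lower_limit \<sigma> l"
  unfolding norm_lower_limit_def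
proof (intro allI impI)
  fix v :: "'y \<Rightarrow>\<^sub>L real" and c
  assume c: "c < norm (v - l)"
  show "\<forall>\<^sub>F n in sequentially. c < norm (v - \<sigma> n)"
  proof (cases "c < 0")
    case True
    then show ?thesis
      by (intro always_eventually allI) (rule less_le_trans, auto)
  next
    case False
    then obtain y where y: "c * norm y < norm (blinfun_apply (v - l) y)"
      using c norm_blinfun_bound[of c "v - l"] by (metis not_less)
    have "(\<lambda>n. norm (blinfun_apply (v - \<sigma> n) y)) \<longlonglongrightarrow> norm (blinfun_apply (v - l) y)"
      unfolding blinfun.diff_left by (intro tendsto_intros lim)
    from order_tendstoD(1)[OF this y] show ?thesis
    proof eventually_elim
      case (elim n)
      also have "norm (blinfun_apply (v - \<sigma> n) y) \<le> norm (v - \<sigma> n) * norm y"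
        by (rule norm_blinfun)
      finally show ?case
        by (rule mult_right_less_imp_less) simp
    qed
  qed
qed

text \<open>Either the norms tend to infinity, and every functional will do, or infinitely many terms
  lie in a fixed ball, which is a multiple of the unit ball.\<close>

lemma weak_star_norm_lower_limit_subseq:
  fixes \<sigma> :: "nat \<Rightarrow> 'y::real_normed_vector \<Rightarrow>\<^sub>L real"
  assumes compact: "seq_compactin weak_star_topology (cball (0 :: 'y \<Rightarrow>\<^sub>L real) 1)"
  shows "\<exists>l r. strict_mono r \<and> norm_lower_limit (\<sigma> \<circ> r) l"
proof (cases "filterlim (\<lambda>n. norm (\<sigma> n)) at_top sequentially")
  case True
  then have "norm_lower_limit (\<sigma> \<circ> id) 0"
    by (simp add: norm_lower_limit_at_infinity)
  then show ?thesis
    using strict_mono_id by blast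
next
  case False
  then obtain B where "\<exists>\<^sub>F n in sequentially. norm (\<sigma> n) \<le> B"
    by (auto simp: filterlim_at_top_dense frequently_def not_le)
  then have inf: "infinite {n. norm (\<sigma> n) \<le> B}"
    by (simp add: frequently_cofinite flip: cofinite_eq_sequentially)
  define r where "r = enumerate {n. norm (\<sigma> n) \<le> B}"
  have r: "strict_mono r"
    unfolding r_def by (rule strict_mono_enumerate[OF inf])
  have bound: "norm (\<sigma> (r n)) \<le> B" for n
    using enumerate_in_set[OF inf, of n] by (simp add: r_def)
  define C where "C = max 1 B"
  have C: "C > 0" "\<And>n. norm (\<sigma> (r n)) \<le> C"
    using bound by (auto simp: C_def le_max_iff_disj)
  have "range (\<lambda>n. (1 / C) *\<^sub>R \<sigma> (r n)) \<subseteq> cball 0 1"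
    using C by (auto simp: field_simps)
  then obtain l s where s: "strict_mono s"
    and "limitin weak_star_topology ((\<lambda>n. (1 / C) *\<^sub>R \<sigma> (r n)) \<circ> s) l sequentially"
    using compact unfolding seq_compactin_def by blast
  then have lim: "(\<lambda>n. blinfun_apply ((1 / C) *\<^sub>R \<sigma> (r (s n))) y) \<longlonglongrightarrow> blinfun_apply l y" for y
    by (simp add: limitin_weak_star_iff)
  have "(\<lambda>n. blinfun_apply ((\<sigma> \<circ> (r \<circ> s)) n) y) \<longlonglongrightarrow> blinfun_apply (C *\<^sub>R l) y" for y
    using tendsto_mult[OF tendsto_const[of C] lim[of y]] C(1) by (simp add: blinfun.scaleR_left)
  then have "norm_lower_limit (\<sigma> \<circ> (r \<circ> s)) (C *\<^sub>R l)"
    by (rule norm_lower_limit_weak_star)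
  then show ?thesis
    using strict_mono_o[OF r s] by blast
qed

lemma norm_lower_limit_subseq_finite:
  fixes x :: "nat \<Rightarrow> 'i \<Rightarrow> 'b::real_normed_vector"
  assumes sub: "\<And>\<sigma> :: nat \<Rightarrow> 'b. \<exists>l r. strict_mono r \<and> norm_lower_limit (\<sigma> \<circ> r) l"
    and "finite I"
  shows "\<exists>l r. strict_mono r \<and> (\<forall>i\<in>I. norm_lower_limit (\<lambda>n. x (r n) i) (l i))"
  using \<open>finite I\<close>
proof induction
  case empty
  then show ?case
    using strict_mono_id by auto
next
  case (insert a I)
  then obtain l r where r: "strict_mono r" "\<And>i. i \<in> I \<Longrightarrow> norm_lower_limit (\<lambda>n. x (r n) i) (l i)"
    by blast
  obtain m s where s: "strict_mono s" "norm_lower_limit ((\<lambda>n. x (r n) a) \<circ> s) m"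
    using sub by blast
  have "norm_lower_limit (\<lambda>n. x ((r \<circ> s) n) i) ((l(a := m)) i)" if "i \<in> insert a I" for i
    using that insert.hyps s norm_lower_limit_subseq[OF r(2) s(1)] by (auto simp: o_def)
  then show ?case
    using strict_mono_o[OF r(1) s(1)] by blast
qed

text \<open>Finitely many sequences compete, so the eventual lower bounds on the individual
  distances hold simultaneously from some index on.\<close>

lemma powr_le_liminf_of_norm_lower_limits:
  fixes y :: "nat \<Rightarrow> 'b::real_normed_vector"
  assumes I: "finite I" "\<And>i. i \<in> I \<Longrightarrow> norm_lower_limit (\<lambda>n. x n i) (l i)"
    and near: "\<And>i. i \<in> I \<Longrightarrow> norm (v - z) \<le> norm (v - l i)"
    and y: "\<And>n. \<exists>i\<in>I. y n = x n i" and p: "0 < p"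
  shows "ennreal (norm (v - z) powr p) \<le> liminf (\<lambda>n. ennreal (norm (v - y n) powr p))"
  unfolding le_Liminf_iff
proof (intro allI impI)
  fix c assume c: "c < ennreal (norm (v - z) powr p)"
  then obtain b where b: "c = ennreal b" "0 \<le> b"
    by (cases c) auto
  \<comment> \<open>\<open>c\<close> is translated into the bound \<open>b powr (1 / p)\<close> on distances.\<close>
  have "b < norm (v - z) powr p"
    using c b by (simp add: ennreal_less_iff)
  then have less: "b powr (1 / p) < norm (v - z)"
    using powr_less_mono2[of "1 / p" b "norm (v - z) powr p"] p b(2) by (simp add: powr_powr)
  have "\<forall>\<^sub>F n in sequentially. \<forall>i\<in>I. b powr (1 / p) < norm (v - x n i)"
    using I near less_le_trans[OF less near] unfolding norm_lower_limit_def
    by (intro eventually_ball_finite) blast+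
  then show "\<forall>\<^sub>F n in sequentially. c < ennreal (norm (v - y n) powr p)"
  proof eventually_elim
    case (elim n)
    then have "b powr (1 / p) < norm (v - y n)"
      using y[of n] by auto
    then have "b < norm (v - y n) powr p"
      using powr_less_mono2[of p "b powr (1 / p)" "norm (v - y n)"] p b(2) by (simp add: powr_powr)
    then show ?case
      using b by (simp add: ennreal_less_iff)
  qed
qed

section \<open>Best approximation\<close>

text \<open>Values that escape to infinity along the minimising sequence stay in the competition, replaced
  by arbitrary vectors. This is harmless: further values to choose from can only bring \<open>g\<close> nearer
  to \<open>f\<close>. If all values escape, then the lower limit in Fatou's lemma is infinite everywhere, and the
  estimate holds for any \<open>g\<close>.\<close>

lemma G_set_minimizer:
  fixes f :: "'a \<Rightarrow> 'b::real_normed_vector"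
  assumes p: "0 < p" and k: "1 \<le> k" and f: "f \<in> bochner_Lp M p"
    and sub: "\<And>\<sigma> :: nat \<Rightarrow> 'b. \<exists>l r. strict_mono r \<and> norm_lower_limit (\<sigma> \<circ> r) l"
  shows "\<exists>g\<in>G_set M p k. \<forall>h\<in>G_set M p k.
    (\<integral>\<^sup>+\<omega>. ennreal (norm (f \<omega> - g \<omega>) powr p) \<partial>M) \<le> (\<integral>\<^sup>+\<omega>. ennreal (norm (f \<omega> - h \<omega>) powr p) \<partial>M)"
proof -
  define J where "J h = (\<integral>\<^sup>+\<omega>. ennreal (norm (f \<omega> - h \<omega>) powr p) \<partial>M)" for h
  define d where "d = (INF h\<in>G_set M p k. J h)"
  have zero: "(\<lambda>_. 0) \<in> G_set M p k"
    using k p by (intro zero_in_G_set) auto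
  then obtain u where u: "decseq u" "range u \<subseteq> J ` G_set M p k" "d = (INF n. u n)"
    using ennreal_Inf_countable_INF[of "J ` G_set M p k"] unfolding d_def by blast
  from u(2) have "\<forall>n. \<exists>h. h \<in> G_set M p k \<and> J h = u n"
    by (auto simp: image_iff subset_iff) metis
  then obtain h where h: "\<And>n. h n \<in> G_set M p k" "\<And>n. J (h n) = u n"
    by metis
  have conv: "(\<lambda>n. J (h n)) \<longlonglongrightarrow> d"
    unfolding h(2) u(3) by (rule LIMSEQ_INF[OF u(1)])
  have "\<forall>n. \<exists>x. \<forall>\<omega>\<in>space M. \<exists>i\<in>{1..k}. h n \<omega> = x i"
    using G_set_values[OF h(1)] by metis
  then obtain x where x: "\<And>n \<omega>. \<omega> \<in> space M \<Longrightarrow> \<exists>i\<in>{1..k}. h n \<omega> = x n i"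
    by metis
  obtain l r where r: "strict_mono r"
    and l: "\<And>i. i \<in> {1..k} \<Longrightarrow> norm_lower_limit (\<lambda>n. x (r n) i) (l i)"
    using norm_lower_limit_subseq_finite[OF sub, of "{1..k}" x] by (meson finite_atLeastAtMost)
  obtain g where near: "\<And>\<omega> j. \<omega> \<in> space M \<Longrightarrow> j \<in> {1..k} \<Longrightarrow> norm (f \<omega> - g \<omega>) \<le> norm (f \<omega> - l j)"
    and g: "J g < \<infinity> \<Longrightarrow> g \<in> G_set M p k"
    using nearest_value_function[OF k less_imp_le[OF p] f, of l] unfolding J_def by blast
  have [measurable]: "(\<lambda>\<omega>. norm (f \<omega> - h n \<omega>)) \<in> borel_measurable M" for n
    using f h(1)[of n] unfolding G_set_def bochner_Lp_def
    by (intro borel_measurable_norm_strongly_measurable strongly_measurable_diff) auto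
  have "J g \<le> (\<integral>\<^sup>+\<omega>. liminf (\<lambda>n. ennreal (norm (f \<omega> - h (r n) \<omega>) powr p)) \<partial>M)"
    unfolding J_def
    by (intro nn_integral_mono powr_le_liminf_of_norm_lower_limits[OF _ l near x] p) auto
  also have "\<dots> \<le> liminf (\<lambda>n. J (h (r n)))"
    unfolding J_def by (intro nn_integral_liminf) measurable
  also have "\<dots> = d"
    using LIMSEQ_subseq_LIMSEQ[OF conv r] by (intro lim_imp_Liminf) (auto simp: o_def)
  finally have le: "J g \<le> d" .
  have min: "J g \<le> J h" if "h \<in> G_set M p k" for h
    using le INF_lower[OF that, of J] unfolding d_def by (rule order_trans)
  have "J (\<lambda>_. 0) < \<infinity>"
    using f by (simp add: J_def bochner_Lp_def)
  then have "g \<in> G_set M p k"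
    using min[OF zero] by (intro g) (rule le_less_trans)
  then show ?thesis
    using min unfolding J_def by blast
qed

theorem theorem1p1:
  fixes M :: "'a measure" and p :: real and k :: nat
    and f :: "'a \<Rightarrow> ('y::banach \<Rightarrow>\<^sub>L real)"
  assumes "1 \<le> p" and "1 \<le> k"
    and "seq_compactin weak_star_topology (cball (0 :: 'y \<Rightarrow>\<^sub>L real) 1)"
    and "f \<in> bochner_Lp M p"
  shows "\<exists>g\<in>G_set M p k.
    Lp_norm M p (\<lambda>\<omega>. f \<omega> - g \<omega>) = (INF h\<in>G_set M p k. Lp_norm M p (\<lambda>\<omega>. f \<omega> - h \<omega>))"
proof -
  have p: "0 < p" "0 \<le> p"
    using assms(1) by auto
  obtain g where g: "g \<in> G_set M p k"
    and min: "\<And>h. h \<in> G_set M p k \<Longrightarrow> (\<integral>\<^sup>+\<omega>. ennreal (norm (f \<omega> - g \<omega>) powr p) \<partial>M)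
      \<le> (\<integral>\<^sup>+\<omega>. ennreal (norm (f \<omega> - h \<omega>) powr p) \<partial>M)"
    using G_set_minimizer[OF p(1) assms(2,4) weak_star_norm_lower_limit_subseq[OF assms(3)]] by blast
  have diff: "(\<lambda>\<omega>. f \<omega> - h \<omega>) \<in> bochner_Lp M p" if "h \<in> G_set M p k" for h
    using that by (intro bochner_Lp_diff p assms(4)) (simp add: G_set_def)
  have "Lp_norm M p (\<lambda>\<omega>. f \<omega> - g \<omega>) \<le> Lp_norm M p (\<lambda>\<omega>. f \<omega> - h \<omega>)" if "h \<in> G_set M p k" for h
    by (rule Lp_norm_mono[OF p(2) diff[OF g] diff[OF that] min[OF that]])
  then have "(INF h\<in>G_set M p k. Lp_norm M p (\<lambda>\<omega>. f \<omega> - h \<omega>)) = Lp_norm M p (\<lambda>\<omega>. f \<omega> - g \<omega>)"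
    using g by (intro cInf_eq_minimum) auto
  then show ?thesis
    using g by (intro bexI[of _ g]) simp
qed

end
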